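(* Let $T$ be a tree and let $\mathrm{MIS}(T)$ be the set of maximal independent sets of $T$. Then: 1. $|\mathrm{MIS}(T)|=1$ if and only if $T$ is a one-vertex graph. 2. $|\mathrm{MIS}(T)|=2$ if and only if $T$ is a star $S^1_{n-1}$ for some $n\ge 2$. 3. $|\mathrm{MIS}(T)|=3$ if and only if $T$ is a bistar $S^2_{p,q}$ for some $p,q\ge 1$. 4. $|\mathrm{MIS}(T)|=4$ if and only if $T$ is an $S^3_{p,q}$ for some $p,q\ge 1$. 5. $|\mathrm{MIS}(T)|=5$ if and only if $T$ is an $S^4_{p,q}$ for some $p,q\ge 1$ or an $S^3_{p,q,r}$ for some $p,q,r\ge 1$.
   Context: Trees are finite with at least one vertex, and "is" means "is isomorphic to". For $n\ge2$, $S^1_{n-1}$ is the star on $n$ vertices. For $i\ge 2$, $S^i_{p,q}$ is the tree obtained from a path $P_i$ on $i$ vertices by adding $p$ pendant vertices adjacent to one end vertex of $P_i$ and $q$ pendant vertices adjacent to the other end vertex of $P_i$; for $i=2$ it is called a bistar. $S^3_{p,q,r}$ is the tree obtained from a path $v_1v_2v_3$ on 3 vertices by adding $p$ pendant vertices adjacent to $v_1$, $q$ pendant vertices adjacent to $v_3$, and $r$ pendant vertices adjacent to $v_2$. A maximal independent set is an independent set not properly contained in another independent set. *)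

theory Defs
  imports "Graph_Theory.Graph_Theory"
begin

text \<open>
  A finite simple graph is a symmetric loop-free finite digraph without parallel arcs
  (\<^locale>\<open>pair_graph\<close>); an undirected edge is represented by a pair of opposite arcs.
  In this representation \<^const>\<open>digraph_iso\<close> is ordinary graph isomorphism.
  The library predicate \<^const>\<open>tree\<close> cannot be used: it regards a pair of opposite arcs as a
  cycle. Excluding closed walks of length two from the cycles yields the undirected notion.
  Connectedness includes nonemptiness of the vertex set.
\<close>

definition undirected_tree :: "'a pair_pre_digraph \<Rightarrow> bool" where
  "undirected_tree G \<longleftrightarrow>
     pair_graph G \<and>
     Digraph_Component.connected (with_proj G) \<and>
     \<not> (\<exists>p. pre_digraph.cycle (with_proj G) p \<and> 3 \<le> length p)"

definition graph_iso :: "'a pair_pre_digraph \<Rightarrow> 'b pair_pre_digraph \<Rightarrow> bool"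
    (infix \<open>\<simeq>\<^sub>g\<close> 50) where
  "G \<simeq>\<^sub>g H \<longleftrightarrow> digraph_iso (with_proj G) (with_proj H)"

definition independent_set :: "'a pair_pre_digraph \<Rightarrow> 'a set \<Rightarrow> bool" where
  "independent_set G A \<longleftrightarrow> A \<subseteq> pverts G \<and> (\<forall>u\<in>A. \<forall>v\<in>A. (u, v) \<notin> parcs G)"

definition MIS :: "'a pair_pre_digraph \<Rightarrow> 'a set set" where
  "MIS G = {A. independent_set G A \<and> \<not> (\<exists>B. independent_set G B \<and> A \<subset> B)}"

text \<open>
  The path \<open>v\<^sub>1 \<dots> v\<^sub>n\<close> with \<open>r k\<close> pendant vertices attached to \<open>v\<^sub>k\<close>: the pair \<open>(k, 0)\<close>
  is \<open>v\<^sub>k\<close>, and \<open>(k, j)\<close> with \<open>j \<ge> 1\<close> is the \<open>j\<close>-th pendant vertex at \<open>v\<^sub>k\<close>.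
\<close>

definition path_with_pendants :: "nat \<Rightarrow> (nat \<Rightarrow> nat) \<Rightarrow> (nat \<times> nat) pair_pre_digraph" where
  "path_with_pendants n r =
     (let E = {((k, 0), (Suc k, 0)) | k. 1 \<le> k \<and> k < n} \<union>
              {((k, 0), (k, j)) | k j. 1 \<le> k \<and> k \<le> n \<and> 1 \<le> j \<and> j \<le> r k}
      in \<lparr> pverts = {(k, j). 1 \<le> k \<and> k \<le> n \<and> j \<le> r k}, parcs = E \<union> E\<inverse> \<rparr>)"

text \<open>\<open>star m\<close> is $S^1_m$, with \<open>m + 1\<close> vertices.\<close>

definition star :: "nat \<Rightarrow> (nat \<times> nat) pair_pre_digraph" where
  "star m = path_with_pendants 1 (\<lambda>_. m)"

text \<open>\<open>S i p q\<close> is $S^i_{p,q}$, intended for \<open>i \<ge> 2\<close>.\<close>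

definition S :: "nat \<Rightarrow> nat \<Rightarrow> nat \<Rightarrow> (nat \<times> nat) pair_pre_digraph" where
  "S i p q = path_with_pendants i (\<lambda>k. if k = 1 then p else if k = i then q else 0)"

text \<open>\<open>S3 p q r\<close> is $S^3_{p,q,r}$; the last argument counts the pendant vertices at the middle
  vertex of the path.\<close>

definition S3 :: "nat \<Rightarrow> nat \<Rightarrow> nat \<Rightarrow> (nat \<times> nat) pair_pre_digraph" where
  "S3 p q r = path_with_pendants 3 (\<lambda>k. if k = 1 then p else if k = 3 then q else r)"

end

theory Submission
  imports Defs
begin

text \<open>
  A maximal independent set of an induced subgraph extends to one of the whole graph, and distinct
  ones have distinct extensions. So a small subtree with many maximal independent sets bounds the
  number for the whole tree from below, and subtrees of trees are always induced
  (\<open>embedded_adj_iff\<close>). Three trees have at least six maximal independent sets: the path on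
  seven vertices, the spider with three legs of length two, and the spider with legs of lengths one,
  two and three (\<open>six_le_card_MIS_of_path7\<close>, \<open>six_le_card_MIS_of_spider222\<close> and
  \<open>six_le_card_MIS_of_spider123\<close>).

  Consider a longest path in a tree that contains none of these. The path has at most six vertices.
  By maximality, the neighbours of its second and second-last vertex that do not lie on the
  path are leaves. If the path has at most four vertices, the tree is therefore a single vertex, a
  star or a bistar. With five vertices on the path, the only other place where something can be
  attached is the middle vertex, and only leaves can be attached there, because the spider with legs
  of length two is excluded; this gives \<open>S\<^sup>3\<^sub>p\<^sub>,\<^sub>q\<close> or \<open>S\<^sup>3\<^sub>p\<^sub>,\<^sub>q\<^sub>,\<^sub>r\<close>. With six, nothing can be attached to
  the third and fourth vertex, because the other spider is excluded; this gives \<open>S\<^sup>4\<^sub>p\<^sub>,\<^sub>q\<close>. This is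
  lemma \<open>classification\<close>.

  Conversely, a maximal independent set of a path with pendant vertices is determined by its trace on
  the path (\<open>card_MIS_path_with_pendants\<close>), and enumerating the possible traces gives 2, 3, 4, 5 and 5
  for the families. A single vertex gives 1. These counts are less than six and pairwise different, except
  for the two families in the last case, so the classification turns into the stated equivalences.
\<close>

section \<open>Maximal independent sets\<close>

lemma independent_set_subset_MIS:
  assumes "finite (pverts G)" "independent_set G A"
  obtains B where "B \<in> MIS G" "A \<subseteq> B"
proof -
  have "finite {B. independent_set G B}"
    by (rule finite_subset[OF _ finite_Pow_iff[THEN iffD2, OF assms(1)]])
      (auto simp: independent_set_def)
  from finite_has_maximal2[OF this, of A] assms(2)
  obtain B where "independent_set G B" "A \<subseteq> B"
    "\<And>C. independent_set G C \<Longrightarrow> B \<subseteq> C \<Longrightarrow> B = C"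
    by auto
  then show thesis
    by (intro that[of B]) (auto simp: MIS_def)
qed

lemma finite_MIS: "finite (pverts G) \<Longrightarrow> finite (MIS G)"
  by (rule finite_subset[of _ "Pow (pverts G)"]) (auto simp: MIS_def independent_set_def)

text \<open>
  Extend each of the given sets to a maximal independent one. An edge between two of the
  given sets persists between their extensions, which are therefore different. This yields lower
  bounds without any need to find the maximal independent sets.
\<close>

lemma length_le_card_MIS:
  assumes fin: "finite (pverts G)"
    and ind: "\<And>A. A \<in> set As \<Longrightarrow> independent_set G A"
    and incompatible: "sorted_wrt (\<lambda>A B. \<exists>a\<in>A. \<exists>b\<in>B. (a, b) \<in> parcs G) As"
  shows "length As \<le> card (MIS G)"
proof -
  define ext where "ext A = (SOME B. B \<in> MIS G \<and> A \<subseteq> B)" for A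
  have ext: "ext A \<in> MIS G \<and> A \<subseteq> ext A" if "A \<in> set As" for A
    unfolding ext_def using independent_set_subset_MIS[OF fin ind[OF that]]
    by (metis (mono_tags, lifting) someI_ex)
  have "sorted_wrt (\<lambda>A B. ext A \<noteq> ext B) As"
    using incompatible
  proof (rule sorted_wrt_mono_rel[rotated])
    fix A B assume AB: "A \<in> set As" "B \<in> set As" "\<exists>a\<in>A. \<exists>b\<in>B. (a, b) \<in> parcs G"
    then obtain a b where "a \<in> ext A" "b \<in> ext B" "(a, b) \<in> parcs G"
      using ext by blast
    then show "ext A \<noteq> ext B"
      using ext AB by (auto simp: MIS_def independent_set_def)
  qed
  then have "distinct (map ext As)"
    by (induction As) auto
  then have "length As = card (ext ` set As)"
    using distinct_card by fastforce
  also have "\<dots> \<le> card (MIS G)"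
    using ext by (intro card_mono finite_MIS fin) auto
  finally show ?thesis .
qed

text \<open>
  Subsets of independent sets are independent, so an independent set that has a proper
  extension has one by a single vertex.
\<close>

lemma MIS_iff_dominating:
  assumes "pair_graph G"
  shows "A \<in> MIS G \<longleftrightarrow>
    A \<subseteq> pverts G \<and> (\<forall>u\<in>pverts G. u \<in> A \<longleftrightarrow> \<not> (\<exists>v\<in>A. (u, v) \<in> parcs G))"
    (is "_ \<longleftrightarrow> ?R")
proof -
  interpret pair_graph G by fact
  have ins: "independent_set G (insert u A) \<longleftrightarrow>
      independent_set G A \<and> u \<in> pverts G \<and> \<not> (\<exists>v\<in>A. (u, v) \<in> parcs G)" for u
    unfolding independent_set_def using arcs_symmetric no_loops' by auto
  have mono: "independent_set G C" if "independent_set G B" "C \<subseteq> B" for B C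
    using that unfolding independent_set_def by blast
  have "A \<in> MIS G \<longleftrightarrow> independent_set G A \<and> (\<forall>u\<in>-A. \<not> independent_set G (insert u A))"
  proof
    assume R: "independent_set G A \<and> (\<forall>u\<in>-A. \<not> independent_set G (insert u A))"
    have "\<not> (\<exists>B. independent_set G B \<and> A \<subset> B)"
    proof
      assume "\<exists>B. independent_set G B \<and> A \<subset> B"
      then obtain B u where "independent_set G B" "insert u A \<subseteq> B" "u \<notin> A"
        by blast
      with mono R show False by blast
    qed
    with R show "A \<in> MIS G" by (simp add: MIS_def)
  qed (auto simp: MIS_def)
  also have "\<dots> \<longleftrightarrow> ?R"
    unfolding ins by (auto simp: independent_set_def)
  finally show ?thesis .
qed

lemma card_MIS_singleton:
  assumes "pair_graph G" "card (pverts G) = 1"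
  shows "card (MIS G) = 1"
proof -
  interpret pair_graph G by fact
  obtain v where v: "pverts G = {v}"
    using assms(2) card_1_singletonE by blast
  have "(u, w) \<notin> parcs G" for u w
    using wellformed'[of u w] no_loops'[of u w] v by auto
  then have "A \<in> MIS G \<longleftrightarrow> A = {v}" for A
    unfolding MIS_iff_dominating[OF assms(1)] using v by auto
  then have "MIS G = {{v}}"
    by blast
  then show ?thesis by simp
qed

section \<open>Graph isomorphism\<close>

text \<open>
  Arcs are pairs of vertices, so the arc component of a digraph isomorphism is determined by
  its vertex component. This lemma and its converse replace digraph isomorphisms by
  adjacency-preserving bijections of the vertices.
\<close>

lemma graph_iso_obtain_bij:
  assumes "G \<simeq>\<^sub>g H"
  obtains h where "bij_betw h (pverts G) (pverts H)"
    and "\<And>u v. u \<in> pverts G \<Longrightarrow> v \<in> pverts G \<Longrightarrow> (u, v) \<in> parcs G \<longleftrightarrow> (h u, h v) \<in> parcs H"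
proof -
  obtain f where f: "pre_digraph.digraph_isomorphism (with_proj G) f"
    and H: "with_proj H = app_iso f (with_proj G)"
    using assms unfolding graph_iso_def digraph_iso_def by blast
  have wf: "wf_digraph (with_proj G)"
    and inj: "inj_on (iso_verts f) (pverts G)"
    and ends: "\<And>e. e \<in> parcs G \<Longrightarrow>
      iso_verts f (fst e) = iso_tail f (iso_arcs f e) \<and> iso_verts f (snd e) = iso_head f (iso_arcs f e)"
    using f by (auto simp: pre_digraph.digraph_isomorphism_def)
  interpret pair_wf_digraph G using wf wf_digraph_wp_iff by auto
  have "verts (with_proj H) = iso_verts f ` pverts G" "arcs (with_proj H) = iso_arcs f ` parcs G"
    "tail (with_proj H) = iso_tail f" "head (with_proj H) = iso_head f"
    by (simp_all add: H)
  then have pH: "pverts H = iso_verts f ` pverts G" "parcs H = iso_arcs f ` parcs G"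
    and th: "iso_tail f = fst" "iso_head f = snd"
    by simp_all
  have arc: "iso_arcs f (u, v) = (iso_verts f u, iso_verts f v)" if "(u, v) \<in> parcs G" for u v
    using ends[OF that] by (simp add: th prod_eq_iff)
  show thesis
  proof (rule that[of "iso_verts f"])
    show "bij_betw (iso_verts f) (pverts G) (pverts H)"
      using inj by (simp add: bij_betw_def pH)
    fix u v assume uv: "u \<in> pverts G" "v \<in> pverts G"
    show "(u, v) \<in> parcs G \<longleftrightarrow> (iso_verts f u, iso_verts f v) \<in> parcs H"
    proof
      assume "(iso_verts f u, iso_verts f v) \<in> parcs H"
      then obtain a b where ab: "(a, b) \<in> parcs G" "iso_arcs f (a, b) = (iso_verts f u, iso_verts f v)"
        by (auto simp: pH)
      then have "iso_verts f a = iso_verts f u" "iso_verts f b = iso_verts f v"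
        by (simp_all add: arc)
      then have "a = u" "b = v"
        using inj uv ab(1) by (meson inj_onD wellformed')+
      with ab show "(u, v) \<in> parcs G" by simp
    qed (force simp: pH arc[symmetric])
  qed
qed

lemma graph_isoI:
  assumes "pair_wf_digraph G" "pair_wf_digraph H"
    and bij: "bij_betw h (pverts G) (pverts H)"
    and arc: "\<And>u v. u \<in> pverts G \<Longrightarrow> v \<in> pverts G \<Longrightarrow> (u, v) \<in> parcs G \<longleftrightarrow> (h u, h v) \<in> parcs H"
  shows "G \<simeq>\<^sub>g H"
proof -
  interpret G: pair_wf_digraph G by fact
  interpret H: pair_wf_digraph H by fact
  define f where "f = \<lparr> iso_verts = h, iso_arcs = map_prod h h, iso_head = snd, iso_tail = fst \<rparr>"
  have inj: "inj_on h (pverts G)" and img: "h ` pverts G = pverts H"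
    using bij by (auto simp: bij_betw_def)
  have sub: "parcs G \<subseteq> pverts G \<times> pverts G"
    by (auto dest: G.wellformed')
  have "inj_on (map_prod h h) (parcs G)"
    by (rule inj_on_subset[OF map_prod_inj_on[OF inj inj] sub])
  then have "pre_digraph.digraph_isomorphism (with_proj G) f"
    using inj G.wf_digraph by (simp add: pre_digraph.digraph_isomorphism_def f_def)
  moreover have "parcs H = map_prod h h ` parcs G"
  proof (intro equalityI subsetI)
    fix e assume e: "e \<in> parcs H"
    obtain x y where xy: "e = (x, y)" by fastforce
    then obtain u v where "u \<in> pverts G" "v \<in> pverts G" "x = h u" "y = h v"
      using e img H.wellformed' by (metis imageE)
    then show "e \<in> map_prod h h ` parcs G"
      using arc e xy by force
  next
    fix e assume "e \<in> map_prod h h ` parcs G"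
    then show "e \<in> parcs H" using arc sub by auto
  qed
  then have "with_proj H = app_iso f (with_proj G)"
    by (simp add: with_proj_def app_iso_def f_def img)
  ultimately show ?thesis
    unfolding graph_iso_def digraph_iso_def by blast
qed

lemma graph_iso_sym:
  assumes "G \<simeq>\<^sub>g H"
  shows "H \<simeq>\<^sub>g G"
proof -
  have "wf_digraph (with_proj G)"
    using assms unfolding graph_iso_def digraph_iso_def pre_digraph.digraph_isomorphism_def by blast
  then show ?thesis
    using assms unfolding graph_iso_def by (rule digraph_iso_swap)
qed

lemma card_MIS_le_of_iso:
  assumes "G \<simeq>\<^sub>g H" and fin: "finite (pverts H)"
  shows "card (MIS G) \<le> card (MIS H)"
proof -
  obtain h where bij: "bij_betw h (pverts G) (pverts H)"
    and arc: "\<And>u v. u \<in> pverts G \<Longrightarrow> v \<in> pverts G \<Longrightarrow> (u, v) \<in> parcs G \<longleftrightarrow> (h u, h v) \<in> parcs H"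
    using graph_iso_obtain_bij[OF assms(1)] by blast
  have inj: "inj_on h (pverts G)" and img: "h ` pverts G = pverts H"
    using bij by (auto simp: bij_betw_def)
  have ind: "independent_set G A \<longleftrightarrow> independent_set H (h ` A)" if "A \<subseteq> pverts G" for A
  proof -
    have "(u, v) \<in> parcs G \<longleftrightarrow> (h u, h v) \<in> parcs H" if "u \<in> A" "v \<in> A" for u v
      using that \<open>A \<subseteq> pverts G\<close> arc by blast
    moreover have "h ` A \<subseteq> pverts H"
      using that img by blast
    ultimately show ?thesis
      using that by (simp add: independent_set_def)
  qed
  have sub: "A \<subseteq> pverts G" if "A \<in> MIS G" for A
    using that by (simp add: MIS_def independent_set_def)
  have "h ` A \<in> MIS H" if A: "A \<in> MIS G" for A
  proof -
    have "\<not> (independent_set H B \<and> h ` A \<subset> B)" for B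
    proof
      assume B: "independent_set H B \<and> h ` A \<subset> B"
      then obtain C where C: "C \<subseteq> pverts G" "B = h ` C"
        using img by (metis independent_set_def subset_imageE)
      then have "A \<subset> C"
        using B sub[OF A] inj_on_image_mem_iff[OF inj _ C(1)] by blast
      with B C ind A show False by (auto simp: MIS_def)
    qed
    then show ?thesis
      using A ind[OF sub[OF A]] by (auto simp: MIS_def)
  qed
  moreover have "inj_on ((`) h) (MIS G)"
    using inj sub by (meson inj_onI inj_on_image_eq_iff)
  ultimately show ?thesis
    by (intro card_inj_on_le finite_MIS fin) auto
qed

lemma card_MIS_cong:
  assumes "G \<simeq>\<^sub>g H" "finite (pverts G)"
  shows "card (MIS G) = card (MIS H)"
proof -
  have "finite (pverts H)"
    using graph_iso_obtain_bij[OF assms(1)] assms(2) bij_betw_finite by metis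
  then show ?thesis
    using card_MIS_le_of_iso[OF assms(1)] card_MIS_le_of_iso[OF graph_iso_sym[OF assms(1)] assms(2)]
    by simp
qed

section \<open>Paths with pendant vertices\<close>

lemma pverts_path_with_pendants:
  "pverts (path_with_pendants n r) = {(k, j). k \<in> {1..n} \<and> j \<le> r k}"
  by (auto simp: path_with_pendants_def Let_def)

lemma parcs_path_with_pendants:
  "((a, i), (b, j)) \<in> parcs (path_with_pendants n r) \<longleftrightarrow>
     a \<in> {1..n} \<and> b \<in> {1..n} \<and>
     (i = 0 \<and> j = 0 \<and> (b = Suc a \<or> a = Suc b) \<or>
      a = b \<and> (i = 0 \<and> j \<in> {1..r a} \<or> j = 0 \<and> i \<in> {1..r a}))"
  by (auto simp: path_with_pendants_def Let_def)

lemma pair_graph_path_with_pendants: "pair_graph (path_with_pendants n r)"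
proof -
  let ?G = "path_with_pendants n r"
  have wf: "u \<in> pverts ?G \<and> v \<in> pverts ?G \<and> u \<noteq> v \<and> (v, u) \<in> parcs ?G" if "(u, v) \<in> parcs ?G" for u v
    using that by (cases u; cases v) (auto simp: pverts_path_with_pendants parcs_path_with_pendants)
  have "pverts ?G = Sigma {1..n} (\<lambda>k. {..r k})"
    by (auto simp: pverts_path_with_pendants)
  then have fin: "finite (pverts ?G)"
    by simp
  have "parcs ?G \<subseteq> pverts ?G \<times> pverts ?G"
    using wf by auto
  then have "finite (parcs ?G)"
    using fin by (meson finite_SigmaI finite_subset)
  moreover have "symmetric (with_proj ?G)"
    using wf by (auto simp: symmetric_def intro: symI)
  ultimately show ?thesis
    using wf fin by unfold_locales (auto simp: symmetric_def)
qed

text \<open>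
  The possible intersections of a maximal independent set with the path \<open>v\<^sub>1 \<dots> v\<^sub>n\<close>, as index
  sets: no two consecutive indices, and a vertex without pendants can be left out only if one of
  its path neighbours is present. Since \<open>0\<close> and \<open>n + 1\<close> are never members, the two ends of the
  path need no special treatment.
\<close>

definition spine_traces :: "nat \<Rightarrow> (nat \<Rightarrow> nat) \<Rightarrow> nat set set" where
  "spine_traces n r = {D \<in> Pow {1..n}. (\<forall>k\<in>D. Suc k \<notin> D) \<and>
     (\<forall>k\<in>{1..n}. k \<in> D \<or> 0 < r k \<or> k - 1 \<in> D \<or> Suc k \<in> D)}"

lemma MIS_path_with_pendants_iff:
  "A \<in> MIS (path_with_pendants n r) \<longleftrightarrow>
     A \<subseteq> {(k, j). k \<in> {1..n} \<and> j \<le> r k} \<and>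
     (\<forall>k\<in>{1..n}. (k, 0) \<in> A \<longleftrightarrow>
        (k - 1, 0) \<notin> A \<and> (Suc k, 0) \<notin> A \<and> (\<forall>j\<in>{1..r k}. (k, j) \<notin> A)) \<and>
     (\<forall>k\<in>{1..n}. \<forall>j\<in>{1..r k}. (k, j) \<in> A \<longleftrightarrow> (k, 0) \<notin> A)"
  (is "_ \<longleftrightarrow> ?sub \<and> ?spine \<and> ?pendant")
proof -
  let ?G = "path_with_pendants n r"
  have spine: "(\<exists>v\<in>A. ((k, 0), v) \<in> parcs ?G) \<longleftrightarrow>
      (k - 1, 0) \<in> A \<or> (Suc k, 0) \<in> A \<or> (\<exists>j\<in>{1..r k}. (k, j) \<in> A)"
    if "?sub" "k \<in> {1..n}" for k
  proof -
    have "Suc k \<in> {1..n}" if "(Suc k, 0) \<in> A" 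
      using that \<open>?sub\<close> by auto
    moreover have "k = Suc (k - 1) \<and> k - 1 \<in> {1..n}" if "(k - 1, 0) \<in> A"
      using that \<open>?sub\<close> by auto
    ultimately show ?thesis
      using \<open>k \<in> {1..n}\<close> by (force simp: parcs_path_with_pendants)
  qed
  have pendant: "(\<exists>v\<in>A. ((k, j), v) \<in> parcs ?G) \<longleftrightarrow> (k, 0) \<in> A"
    if "k \<in> {1..n}" "j \<in> {1..r k}" for k j
    using that by (auto simp: parcs_path_with_pendants Bex_def)
  have split: "(\<forall>u\<in>pverts ?G. P u) \<longleftrightarrow>
      (\<forall>k\<in>{1..n}. P (k, 0)) \<and> (\<forall>k\<in>{1..n}. \<forall>j\<in>{1..r k}. P (k, j))" for P
  proof -
    have "(\<forall>u\<in>pverts ?G. P u) \<longleftrightarrow> (\<forall>k\<in>{1..n}. \<forall>j\<le>r k. P (k, j))"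
      by (auto simp: pverts_path_with_pendants)
    also have "\<dots> \<longleftrightarrow> (\<forall>k\<in>{1..n}. P (k, 0)) \<and> (\<forall>k\<in>{1..n}. \<forall>j\<in>{1..r k}. P (k, j))"
    proof (intro iffI conjI ballI allI impI)
      fix k j assume P: "(\<forall>k\<in>{1..n}. P (k, 0)) \<and> (\<forall>k\<in>{1..n}. \<forall>j\<in>{1..r k}. P (k, j))"
        and "k \<in> {1..n}" "j \<le> r k"
      then show "P (k, j)"
        by (cases "j = 0") auto
    qed auto
    finally show ?thesis .
  qed
  show ?thesis
  proof (cases ?sub)
    case True
    then show ?thesis
      unfolding MIS_iff_dominating[OF pair_graph_path_with_pendants] split
      using spine[OF True] pendant by (simp add: pverts_path_with_pendants)
  qed (simp add: MIS_iff_dominating[OF pair_graph_path_with_pendants] pverts_path_with_pendants)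
qed

text \<open>
  A maximal independent set is determined by its trace on the path: the pendant vertices at
  \<open>v\<^sub>k\<close> all belong to it if \<open>v\<^sub>k\<close> does not, and none of them does otherwise. Hence only whether
  there are pendants at \<open>v\<^sub>k\<close> matters, not how many.
\<close>

lemma card_MIS_path_with_pendants:
  "card (MIS (path_with_pendants n r)) = card (spine_traces n r)"
proof -
  let ?trace = "\<lambda>A. {k. (k, 0) \<in> A}"
  let ?fill = "\<lambda>D. {(k, 0) |k. k \<in> D} \<union> {(k, j) |k j. k \<in> {1..n} - D \<and> j \<in> {1..r k}}"
  have "bij_betw ?trace (MIS (path_with_pendants n r)) (spine_traces n r)"
  proof (rule bij_betw_byWitness[where f' = ?fill])
    show "\<forall>A\<in>MIS (path_with_pendants n r). ?fill (?trace A) = A"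
    proof
      fix A assume "A \<in> MIS (path_with_pendants n r)"
      then have sub: "A \<subseteq> {(k, j). k \<in> {1..n} \<and> j \<le> r k}"
        and spine: "\<And>k. k \<in> {1..n} \<Longrightarrow> (k, 0) \<in> A \<longleftrightarrow>
          (k - 1, 0) \<notin> A \<and> (Suc k, 0) \<notin> A \<and> (\<forall>j\<in>{1..r k}. (k, j) \<notin> A)"
        and pendant: "\<And>k j. k \<in> {1..n} \<Longrightarrow> j \<in> {1..r k} \<Longrightarrow> (k, j) \<in> A \<longleftrightarrow> (k, 0) \<notin> A"
        unfolding MIS_path_with_pendants_iff by blast+
      show "?fill (?trace A) = A"
      proof (rule set_eqI)
        fix x :: "nat \<times> nat"
        obtain k j where x: "x = (k, j)" by fastforce
        show "x \<in> ?fill (?trace A) \<longleftrightarrow> x \<in> A"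
        proof (cases "j = 0")
          case False
          have "(k, j) \<in> A \<longleftrightarrow> k \<in> {1..n} \<and> j \<in> {1..r k} \<and> (k, 0) \<notin> A"
          proof (cases "k \<in> {1..n} \<and> j \<in> {1..r k}")
            case True
            then show ?thesis by (simp add: pendant)
          next
            case outside: False
            then have "(k, j) \<notin> A"
              using subsetD[OF sub, of "(k, j)"] False by auto
            with outside show ?thesis by blast
          qed
          then show ?thesis
            using x False by auto
        qed (simp add: x)
      qed
    qed
    show "\<forall>D\<in>spine_traces n r. ?trace (?fill D) = D"
      by auto
    show "?trace ` MIS (path_with_pendants n r) \<subseteq> spine_traces n r"
    proof (rule image_subsetI)
      fix A assume "A \<in> MIS (path_with_pendants n r)"
      then have sub: "A \<subseteq> {(k, j). k \<in> {1..n} \<and> j \<le> r k}"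
        and spine: "\<And>k. k \<in> {1..n} \<Longrightarrow> (k, 0) \<in> A \<longleftrightarrow>
          (k - 1, 0) \<notin> A \<and> (Suc k, 0) \<notin> A \<and> (\<forall>j\<in>{1..r k}. (k, j) \<notin> A)"
        and pendant: "\<And>k j. k \<in> {1..n} \<Longrightarrow> j \<in> {1..r k} \<Longrightarrow> (k, j) \<in> A \<longleftrightarrow> (k, 0) \<notin> A"
        unfolding MIS_path_with_pendants_iff by blast+
      have centre: "k \<in> {1..n}" if "(k, 0) \<in> A" for k
        using sub that by auto
      have "(Suc k, 0) \<notin> A" if "(k, 0) \<in> A" for k
        using spine[OF centre[OF that]] that by blast
      moreover have "(k, 0) \<in> A \<or> 0 < r k \<or> (k - 1, 0) \<in> A \<or> (Suc k, 0) \<in> A"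
        if "k \<in> {1..n}" for k
        using spine[OF that] by (cases "r k") auto
      ultimately show "?trace A \<in> spine_traces n r"
        using centre by (auto simp: spine_traces_def)
    qed
    show "?fill ` spine_traces n r \<subseteq> MIS (path_with_pendants n r)"
    proof (rule image_subsetI)
      fix D assume "D \<in> spine_traces n r"
      then have sub: "D \<subseteq> {1..n}" and indep: "\<And>k. k \<in> D \<Longrightarrow> Suc k \<notin> D"
        and dom: "\<And>k. k \<in> {1..n} \<Longrightarrow> k \<in> D \<or> 0 < r k \<or> k - 1 \<in> D \<or> Suc k \<in> D"
        unfolding spine_traces_def by blast+
      have mem0: "(k, 0) \<in> ?fill D \<longleftrightarrow> k \<in> D" for k
        by auto
      have memp: "(k, j) \<in> ?fill D \<longleftrightarrow> k \<notin> D" if "k \<in> {1..n}" "j \<in> {1..r k}" for k j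
        using that by auto
      have "k \<in> D \<longleftrightarrow> k - 1 \<notin> D \<and> Suc k \<notin> D \<and> (\<forall>j\<in>{1..r k}. k \<in> D)" if k: "k \<in> {1..n}" for k
      proof
        assume "k \<in> D"
        moreover have "k = Suc (k - 1)"
          using k by simp
        ultimately show "k - 1 \<notin> D \<and> Suc k \<notin> D \<and> (\<forall>j\<in>{1..r k}. k \<in> D)"
          using indep by metis
      next
        assume R: "k - 1 \<notin> D \<and> Suc k \<notin> D \<and> (\<forall>j\<in>{1..r k}. k \<in> D)"
        then have "k \<in> D \<or> 0 < r k"
          using dom[OF k] by metis
        with R show "k \<in> D"
          by (cases "r k") auto
      qed
      moreover have "?fill D \<subseteq> {(k, j). k \<in> {1..n} \<and> j \<le> r k}"
        using sub by auto
      ultimately show "?fill D \<in> MIS (path_with_pendants n r)"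
        unfolding MIS_path_with_pendants_iff mem0 using memp by simp
    qed
  qed
  then show ?thesis
    by (rule bij_betw_same_card)
qed

text \<open>
  An opaque wrapper, so that the recursion below can serve as a rewrite system which
  enumerates the subsets of an explicit finite set while the predicate still has parameters.
\<close>

definition count_subsets :: "('a set \<Rightarrow> bool) \<Rightarrow> 'a set \<Rightarrow> nat" where
  "count_subsets P X = card {D \<in> Pow X. P D}"

lemma count_subsets_empty: "count_subsets P {} = (if P {} then 1 else 0)"
proof -
  have "{D \<in> Pow {}. P D} = (if P {} then {{}} else {})"
    by auto
  then show ?thesis by (simp add: count_subsets_def)
qed

lemma count_subsets_insert:
  assumes "finite X" "a \<notin> X"
  shows "count_subsets P (insert a X) = count_subsets P X + count_subsets (\<lambda>D. P (insert a D)) X"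
proof -
  have "{D \<in> Pow (insert a X). P D} =
      {D \<in> Pow X. P D} \<union> insert a ` {D \<in> Pow X. P (insert a D)}"
    by (auto simp: Pow_insert)
  moreover have "inj_on (insert a) (Pow X)"
    using assms(2) by (intro inj_onI) (metis Diff_insert_absorb PowD subsetD)
  then have "inj_on (insert a) {D \<in> Pow X. P (insert a D)}"
    by (rule inj_on_subset) auto
  moreover have "{D \<in> Pow X. P D} \<inter> insert a ` {D \<in> Pow X. P (insert a D)} = {}"
    using assms(2) by auto
  ultimately show ?thesis
    using assms(1) by (simp add: count_subsets_def card_Un_disjoint card_image)
qed

lemma card_spine_traces:
  "card (spine_traces n r) = count_subsets (\<lambda>D. (\<forall>k\<in>D. Suc k \<notin> D) \<and>
     (\<forall>k\<in>{1..n}. k \<in> D \<or> 0 < r k \<or> k - 1 \<in> D \<or> Suc k \<in> D)) {1..n}"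
  by (simp only: spine_traces_def count_subsets_def)

lemma one_to_numeral:
  "{Suc 0..2} = {1, 2}" "{Suc 0..3} = {1, 2, 3}" "{Suc 0..4} = {1, 2, 3, 4}"
  by auto

lemmas count_MIS = card_MIS_path_with_pendants card_spine_traces one_to_numeral
  count_subsets_insert count_subsets_empty

lemma card_MIS_star: "1 \<le> m \<Longrightarrow> card (MIS (star m)) = 2"
  by (simp add: star_def count_MIS)

lemma card_MIS_S2: "1 \<le> p \<Longrightarrow> 1 \<le> q \<Longrightarrow> card (MIS (S 2 p q)) = 3"
  by (simp add: S_def count_MIS)

lemma card_MIS_S3: "1 \<le> p \<Longrightarrow> 1 \<le> q \<Longrightarrow> card (MIS (S 3 p q)) = 4"
  by (simp add: S_def count_MIS)

lemma card_MIS_S4: "1 \<le> p \<Longrightarrow> 1 \<le> q \<Longrightarrow> card (MIS (S 4 p q)) = 5"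
  by (simp add: S_def count_MIS)

lemma card_MIS_S3_middle:
  "1 \<le> p \<Longrightarrow> 1 \<le> q \<Longrightarrow> 1 \<le> r \<Longrightarrow> card (MIS (S3 p q r)) = 5"
  by (simp add: S3_def count_MIS)

section \<open>Subtrees and induced subgraphs of a tree\<close>

text \<open>
  Walks are lists of arcs in the definition of cycles. Pairing a vertex list with its tail
  gives the arcs of the walk along it, so that all other arguments can use vertex lists.
\<close>

lemma pcas_zip:
  "pcas u (zip (u # ys) ys) (last (u # ys)) \<and> pawalk_verts u (zip (u # ys) ys) = u # ys"
  by (induction ys arbitrary: u) auto

lemma set_zip_successively: "successively (\<lambda>u v. (u, v) \<in> E) (u # ys) \<Longrightarrow> set (zip (u # ys) ys) \<subseteq> E"
  by (induction ys arbitrary: u) auto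

locale undirected_tree_graph =
  fixes T :: "'a pair_pre_digraph"
  assumes undirected_tree: "undirected_tree T"
begin

sublocale pair_graph T
  using undirected_tree by (simp add: undirected_tree_def)

abbreviation adj :: "'a \<Rightarrow> 'a \<Rightarrow> bool" where
  "adj u v \<equiv> (u, v) \<in> parcs T"

lemma adj_sym: "adj u v \<longleftrightarrow> adj v u"
  using arcs_symmetric by blast

lemma adj_irrefl [simp]: "\<not> adj u u"
  using no_loops' by blast

lemma closed_eq_pverts:
  assumes "u \<in> X" "X \<subseteq> pverts T" and closed: "\<And>v w. v \<in> X \<Longrightarrow> adj v w \<Longrightarrow> w \<in> X"
  shows "X = pverts T"
proof
  have "strongly_connected (with_proj T)"
    using undirected_tree symmetric_connected_imp_strongly_connected pair_sym_arcs
    by (simp add: undirected_tree_def)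
  show "pverts T \<subseteq> X"
  proof
    fix v assume "v \<in> pverts T"
    then have "u \<rightarrow>\<^sup>*\<^bsub>with_proj T\<^esub> v"
      using \<open>strongly_connected (with_proj T)\<close> assms(1,2) by (auto simp: strongly_connected_def)
    then show "v \<in> X"
      by (induction rule: reachable_induct) (use assms closed in auto)
  qed
qed fact

lemma no_closed_path:
  assumes "distinct xs" "successively adj xs" "3 \<le> length xs" "adj (last xs) (hd xs)"
  shows False
proof -
  obtain u ys where xs: "xs = u # ys" "ys \<noteq> []"
    using assms(3) by (cases xs) fastforce+
  let ?p = "zip (u # ys @ [u]) (ys @ [u])"
  have "successively adj (u # (ys @ [u]))"
    using assms(2,4) xs by (auto simp: successively_append_iff successively_Cons)
  then have "set ?p \<subseteq> parcs T"
    by (rule set_zip_successively)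
  moreover have "pcas u ?p u" "pawalk_verts u ?p = u # ys @ [u]"
    using pcas_zip[of u "ys @ [u]"] by auto
  moreover have "u \<in> pverts T"
    using assms(2) xs by (auto simp: successively_Cons dest: wellformed')
  ultimately have "cycle ?p"
    unfolding cycle_def awalk_def using assms(1) xs by (intro exI[of _ u]) auto
  moreover have "3 \<le> length ?p"
    using assms(3) xs by simp
  ultimately show False
    using undirected_tree by (auto simp: undirected_tree_def)
qed

text \<open>
  Growing a connected vertex set one vertex at a time makes the existence of paths between its
  members an easy induction, and it is how the configurations below are built.
\<close>

inductive subtree :: "'a set \<Rightarrow> bool" where
  singleton: "u \<in> pverts T \<Longrightarrow> subtree {u}"
| grow: "subtree H \<Longrightarrow> u \<in> H \<Longrightarrow> adj u w \<Longrightarrow> w \<notin> H \<Longrightarrow> subtree (insert w H)"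

lemma subtree_path:
  assumes "subtree H" "u \<in> H" "v \<in> H"
  shows "\<exists>xs. xs \<noteq> [] \<and> hd xs = u \<and> last xs = v \<and> distinct xs \<and> successively adj xs \<and> set xs \<subseteq> H"
  using assms
proof (induction arbitrary: u v)
  case (singleton a)
  then show ?case by (intro exI[of _ "[a]"]) auto
next
  case (grow H p w)
  note hyps = \<open>p \<in> H\<close> \<open>adj p w\<close> \<open>w \<notin> H\<close>
  consider "u = w" "v = w" | "u = w" "v \<in> H" | "u \<in> H" "v = w" | "u \<in> H" "v \<in> H"
    using grow.prems by blast
  then show ?case
  proof cases
    case 1
    then show ?thesis by (intro exI[of _ "[w]"]) simp
  next
    case 2
    from grow.IH[OF \<open>p \<in> H\<close> 2(2)] obtain xs where xs: "xs \<noteq> [] \<and> hd xs = p \<and> last xs = v \<and>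
        distinct xs \<and> successively adj xs \<and> set xs \<subseteq> H" ..
    then have "w \<notin> set xs"
      using hyps by blast
    then show ?thesis
      using xs 2 arcs_symmetric[OF \<open>adj p w\<close>]
      by (intro exI[of _ "w # xs"]) (simp add: successively_Cons subset_insertI2)
  next
    case 3
    from grow.IH[OF 3(1) \<open>p \<in> H\<close>] obtain xs where xs: "xs \<noteq> [] \<and> hd xs = u \<and> last xs = p \<and>
        distinct xs \<and> successively adj xs \<and> set xs \<subseteq> H" ..
    then have "w \<notin> set xs"
      using hyps by blast
    then show ?thesis
      using xs 3 \<open>adj p w\<close>
      by (intro exI[of _ "xs @ [w]"]) (simp add: successively_append_iff subset_insertI2)
  next
    case 4
    from grow.IH[OF 4] obtain xs where "xs \<noteq> [] \<and> hd xs = u \<and> last xs = v \<and>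
        distinct xs \<and> successively adj xs \<and> set xs \<subseteq> H" ..
    then show ?thesis by (intro exI[of _ xs]) (simp add: subset_insertI2)
  qed
qed

text \<open>
  Two neighbours in the subtree, joined by a path inside it, would close a cycle through the
  outside vertex. The absence of cycles enters the later arguments only through this
  lemma.
\<close>

lemma unique_neighbour:
  assumes "subtree H" "w \<notin> H" "u \<in> H" "v \<in> H" "adj w u" "adj w v"
  shows "u = v"
proof (rule ccontr)
  assume "u \<noteq> v"
  obtain xs where xs: "xs \<noteq> []" "hd xs = u" "last xs = v" "distinct xs" "successively adj xs" "set xs \<subseteq> H"
    using subtree_path[OF assms(1,3,4)] by blast
  with \<open>u \<noteq> v\<close> have "2 \<le> length xs"
    by (cases xs rule: list.exhaust; cases "tl xs") auto
  then show False
    using no_closed_path[of "w # xs"] xs assms arcs_symmetric[OF assms(6)]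
    by (auto simp: successively_Cons)
qed

text \<open>
  A rooted tree on the positions \<open>0, \<dots>, length vs - 1\<close>, given by its parent function, and
  realised in the graph by the list of vertices. Every parent precedes its children, so each
  prefix of the list spans a subtree.
\<close>

definition embedded :: "(nat \<Rightarrow> nat) \<Rightarrow> 'a list \<Rightarrow> bool" where
  "embedded par vs \<longleftrightarrow> vs \<noteq> [] \<and> distinct vs \<and> set vs \<subseteq> pverts T \<and>
     (\<forall>j. 0 < j \<and> j < length vs \<longrightarrow> par j < j \<and> adj (vs ! par j) (vs ! j))"

lemma embedded_subtree:
  assumes "embedded par vs" "m < length vs"
  shows "subtree (set (take (Suc m) vs))"
  using assms(2)
proof (induction m)
  case 0
  then show ?case
    using assms(1) subtree.singleton[of "hd vs"] by (cases vs) (auto simp: embedded_def)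
next
  case (Suc m)
  have "vs ! par (Suc m) \<in> set (take (Suc m) vs)" "adj (vs ! par (Suc m)) (vs ! Suc m)"
    using assms(1) Suc.prems by (auto simp: embedded_def in_set_conv_nth)
  moreover have "vs ! Suc m \<notin> set (take (Suc m) vs)"
    using assms(1) Suc.prems by (auto simp: embedded_def in_set_conv_nth nth_eq_iff_index_eq)
  ultimately show ?case
    using subtree.grow[OF Suc.IH] Suc.prems take_Suc_conv_app_nth[of "Suc m" vs] by simp
qed

lemma embedded_subtree_all: "embedded par vs \<Longrightarrow> subtree (set vs)"
  using embedded_subtree[of par vs "length vs - 1"] by (cases vs) (auto simp: embedded_def)

text \<open>
  A new vertex has only one neighbour among the earlier ones, namely its parent; hence a tree
  embedded in a tree is an induced subgraph.
\<close>

lemma embedded_adj_iff: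
  assumes "embedded par vs" "i < j" "j < length vs"
  shows "adj (vs ! i) (vs ! j) \<longleftrightarrow> i = par j"
proof
  assume adj: "adj (vs ! i) (vs ! j)"
  let ?H = "set (take (Suc (j - 1)) vs)"
  have j: "par j < j" "adj (vs ! par j) (vs ! j)" "distinct vs"
    using assms by (auto simp: embedded_def)
  have "vs ! i = vs ! par j"
  proof (rule unique_neighbour)
    show "subtree ?H"
      using assms by (intro embedded_subtree) auto
    show "vs ! j \<notin> ?H"
      using j assms by (auto simp: in_set_conv_nth nth_eq_iff_index_eq)
    show "vs ! i \<in> ?H" "vs ! par j \<in> ?H"
      using j assms by (auto simp: in_set_conv_nth)
  qed (use arcs_symmetric[OF adj] arcs_symmetric[OF j(2)] in auto)
  then show "i = par j"
    using j assms by (simp add: nth_eq_iff_index_eq)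
qed (use assms in \<open>auto simp: embedded_def\<close>)

text \<open>
  Transfers the lower bound to index sets, so that for a concrete parent function all its
  hypotheses become computations with numerals.
\<close>

lemma length_le_card_MIS_of_embedded:
  assumes emb: "embedded par vs"
    and range: "\<forall>I\<in>set Is. \<forall>i\<in>set I. i < length vs"
    and ind: "\<forall>I\<in>set Is. \<forall>i\<in>set I. \<forall>j\<in>set I. i < j \<longrightarrow> i \<noteq> par j"
    and incompatible: "sorted_wrt (\<lambda>I J. \<exists>i\<in>set I. \<exists>j\<in>set J. i < j \<and> i = par j \<or> j < i \<and> j = par i) Is"
  shows "length Is \<le> card (MIS T)"
proof -
  let ?f = "\<lambda>I. (!) vs ` set I"
  have "length (map ?f Is) \<le> card (MIS T)"
  proof (rule length_le_card_MIS)
    show "finite (pverts T)" by (rule pair_finite_verts)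
    fix A assume "A \<in> set (map ?f Is)"
    then obtain I where I: "I \<in> set Is" "A = ?f I" by auto
    have "\<not> adj (vs ! i) (vs ! j)" if "i \<in> set I" "j \<in> set I" for i j
    proof (cases i j rule: linorder_cases)
      case less
      then show ?thesis
        using that I(1) range ind embedded_adj_iff[OF emb less] by blast
    next
      case greater
      then have "\<not> adj (vs ! j) (vs ! i)"
        using that I(1) range ind embedded_adj_iff[OF emb greater] by blast
      then show ?thesis using arcs_symmetric by blast
    qed simp
    then show "independent_set T A"
      using I range emb by (fastforce simp: independent_set_def embedded_def)
  next
    show "sorted_wrt (\<lambda>A B. \<exists>a\<in>A. \<exists>b\<in>B. adj a b) (map ?f Is)"
      unfolding sorted_wrt_map
    proof (rule sorted_wrt_mono_rel[OF _ incompatible])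
      fix I J assume IJ: "I \<in> set Is" "J \<in> set Is"
        and "\<exists>i\<in>set I. \<exists>j\<in>set J. i < j \<and> i = par j \<or> j < i \<and> j = par i"
      then obtain i j where "i \<in> set I" "j \<in> set J" "i < j \<and> i = par j \<or> j < i \<and> j = par i"
        by blast
      moreover from this have "adj (vs ! i) (vs ! j)"
        using embedded_adj_iff[OF emb, of i j] embedded_adj_iff[OF emb, of j i] IJ range adj_sym
        by blast
      ultimately show "\<exists>a\<in>?f I. \<exists>b\<in>?f J. adj a b"
        by blast
    qed
  qed
  then show ?thesis by simp
qed

text \<open>
  The three minimal trees with at least six maximal independent sets that matter here are the
  path on seven vertices and the spiders with legs of lengths \<open>2, 2, 2\<close> and \<open>1, 2, 3\<close>. The lists
  of index sets are maximal independent sets of these trees; six of them suffice. In a spider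
  position \<open>0\<close> is the centre.
\<close>

lemma six_le_card_MIS_of_path7:
  assumes "embedded (\<lambda>j. j - 1) vs" "length vs = 7"
  shows "6 \<le> card (MIS T)"
  using length_le_card_MIS_of_embedded[OF assms(1),
      of "[[0,2,4,6], [0,2,5], [0,3,5], [0,3,6], [1,3,5], [1,3,6]]"] assms(2)
  by simp

lemma six_le_card_MIS_of_spider222:
  assumes "embedded (\<lambda>j. [0,0,1,0,3,0,5] ! j) vs" "length vs = 7"
  shows "6 \<le> card (MIS T)"
  using length_le_card_MIS_of_embedded[OF assms(1),
      of "[[0,2,4,6], [1,4,6], [2,3,6], [2,4,5], [1,3,6], [1,4,5]]"] assms(2)
  by simp

lemma six_le_card_MIS_of_spider123:
  assumes "embedded (\<lambda>j. [0,0,0,2,0,4,5] ! j) vs" "length vs = 7"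
  shows "6 \<le> card (MIS T)"
  using length_le_card_MIS_of_embedded[OF assms(1),
      of "[[0,3,5], [0,3,6], [1,2,4,6], [1,2,5], [1,3,4,6], [1,3,5]]"] assms(2)
  by simp

section \<open>Recognising a path with pendant vertices\<close>

text \<open>
  It suffices to know the neighbourhoods of the vertices on the path and of their remaining
  neighbours: these vertices form a set closed under adjacency, so by connectedness there are
  no others.
\<close>

lemma iso_path_with_pendants:
  assumes "1 \<le> n" and inj: "inj_on c {1..n}" and sub: "c ` {1..n} \<subseteq> pverts T"
    and spine: "\<And>k l. k \<in> {1..n} \<Longrightarrow> l \<in> {1..n} \<Longrightarrow> adj (c k) (c l) \<longleftrightarrow> l = Suc k \<or> k = Suc l"
    and leaf: "\<And>k y z. k \<in> {1..n} \<Longrightarrow> adj (c k) y \<Longrightarrow> y \<notin> c ` {1..n} \<Longrightarrow> adj y z \<Longrightarrow> z = c k"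
    and r: "\<And>k. k \<in> {1..n} \<Longrightarrow> r k = card ({y. adj (c k) y} - c ` {1..n})"
  shows "T \<simeq>\<^sub>g path_with_pendants n r"
proof -
  let ?P = "path_with_pendants n r"
  define L where "L k = {y. adj (c k) y} - c ` {1..n}" for k
  have L_pverts: "L k \<subseteq> pverts T" for k
    using wellformed' by (auto simp: L_def)
  have L_adj: "adj y z \<longleftrightarrow> z = c k" if "k \<in> {1..n}" "y \<in> L k" for k y z
    using that leaf arcs_symmetric unfolding L_def by blast
  have L_spine: "c l \<notin> L k" if "l \<in> {1..n}" for l k
    using that by (simp add: L_def)
  have "\<exists>g. bij_betw g {1..r k} (L k)" if "k \<in> {1..n}" for k
    unfolding r[OF that] L_def[symmetric]
    using ex_bij_betw_nat_finite_1 finite_subset[OF L_pverts pair_finite_verts] by blast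
  then obtain g where g: "\<And>k. k \<in> {1..n} \<Longrightarrow> bij_betw (g k) {1..r k} (L k)"
    by metis
  have gL: "g k j \<in> L k" if "k \<in> {1..n}" "j \<in> {1..r k}" for k j
    using bij_betwE[OF g[OF that(1)]] that(2) by blast
  define h where "h = (\<lambda>(k, j). if j = 0 then c k else g k j)"
  have vert: "k \<in> {1..n} \<and> (j = 0 \<or> j \<in> {1..r k})" if "(k, j) \<in> pverts ?P" for k j
    using that by (auto simp: pverts_path_with_pendants)
  have "inj_on h (pverts ?P)"
  proof (rule inj_onI, clarify)
    fix k i l j
    assume P: "(k, i) \<in> pverts ?P" "(l, j) \<in> pverts ?P" and eq: "h (k, i) = h (l, j)"
    note V = vert[OF P(1)] vert[OF P(2)]
    consider "i = 0" "j = 0" | "i = 0" "j \<in> {1..r l}" | "i \<in> {1..r k}" "j = 0"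
      | "i \<in> {1..r k}" "j \<in> {1..r l}"
      using V by blast
    then show "k = l \<and> i = j"
    proof cases
      case 1
      then show ?thesis using V eq inj by (simp add: h_def inj_on_eq_iff)
    next
      case 2
      then show ?thesis using V eq gL[of l j] L_spine[of k l] by (simp add: h_def)
    next
      case 3
      then show ?thesis using V eq gL[of k i] L_spine[of l k] by (simp add: h_def)
    next
      case 4
      then have g_eq: "g k i = g l j"
        using eq by (simp add: h_def)
      then have "c k = c l"
        using V 4 gL[of k i] gL[of l j] L_adj[of k "g k i" "c k"] L_adj[of l "g k i" "c k"] by simp
      then have "k = l"
        using V inj by (simp add: inj_on_eq_iff)
      then show ?thesis
        using V 4 g_eq bij_betw_imp_inj_on[OF g[of k]] by (simp add: inj_on_eq_iff)
    qed
  qed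
  moreover have "h ` pverts ?P = pverts T"
  proof (rule closed_eq_pverts)
    have spine_mem: "c k \<in> h ` pverts ?P" if "k \<in> {1..n}" for k
      using that by (intro image_eqI[of _ _ "(k, 0)"]) (auto simp: h_def pverts_path_with_pendants)
    have L_mem: "y \<in> h ` pverts ?P" if k: "k \<in> {1..n}" and y: "y \<in> L k" for k y
    proof -
      obtain j where "j \<in> {1..r k}" "y = g k j"
        using y bij_betw_imp_surj_on[OF g[OF k]] by blast
      then show ?thesis
        using k by (intro image_eqI[of _ _ "(k, j)"]) (auto simp: h_def pverts_path_with_pendants)
    qed
    show "c 1 \<in> h ` pverts ?P"
      using spine_mem assms(1) by simp
    have cases: "(\<exists>k\<in>{1..n}. v = c k) \<or> (\<exists>k\<in>{1..n}. v \<in> L k)" if "v \<in> h ` pverts ?P" for v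
    proof -
      obtain k j where "(k, j) \<in> pverts ?P" "v = h (k, j)"
        using \<open>v \<in> h ` pverts ?P\<close> by auto
      then show ?thesis
        using vert[of k j] gL[of k j] by (auto simp: h_def)
    qed
    show "h ` pverts ?P \<subseteq> pverts T"
      using cases sub L_pverts by blast
    fix v w assume "v \<in> h ` pverts ?P" "adj v w"
    from cases[OF this(1)] show "w \<in> h ` pverts ?P"
    proof (elim disjE bexE)
      fix k assume k: "k \<in> {1..n}" "v = c k"
      show ?thesis
      proof (cases "w \<in> c ` {1..n}")
        case True
        then show ?thesis using spine_mem by blast
      next
        case False
        then have "w \<in> L k" using k \<open>adj v w\<close> by (simp add: L_def)
        then show ?thesis using L_mem k by blast
      qed
    next
      fix k assume "k \<in> {1..n}" "v \<in> L k"
      then show ?thesis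
        using L_adj[of k v w] \<open>adj v w\<close> spine_mem by simp
    qed
  qed
  ultimately have bij: "bij_betw h (pverts ?P) (pverts T)"
    by (simp add: bij_betw_def)
  have arc: "(u, v) \<in> parcs ?P \<longleftrightarrow> adj (h u) (h v)" if uv: "u \<in> pverts ?P" "v \<in> pverts ?P" for u v
  proof -
    obtain k i l j where u: "u = (k, i)" and v: "v = (l, j)"
      by (cases u; cases v) blast
    note V = vert[of k i] vert[of l j]
    have L_arc: "adj (g a b) (c a') \<longleftrightarrow> a = a'" if "a \<in> {1..n}" "b \<in> {1..r a}" "a' \<in> {1..n}" for a b a'
      using L_adj[OF that(1) gL[OF that(1,2)]] that inj by (auto simp: inj_on_eq_iff)
    consider "i = 0" "j = 0" | "i = 0" "j \<in> {1..r l}" | "i \<in> {1..r k}" "j = 0"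
      | "i \<in> {1..r k}" "j \<in> {1..r l}"
      using V uv u v by blast
    then show ?thesis
    proof cases
      case 1
      then show ?thesis
        using V uv u v spine[of k l] by (simp add: h_def parcs_path_with_pendants)
    next
      case 2
      then have "adj (c k) (g l j) \<longleftrightarrow> l = k"
        using L_arc[of l j k] V uv u v arcs_symmetric by blast
      then show ?thesis
        using 2 V uv u v by (auto simp: h_def parcs_path_with_pendants)
    next
      case 3
      then show ?thesis
        using V uv u v L_arc[of k i l] by (auto simp: h_def parcs_path_with_pendants)
    next
      case 4
      then have "\<not> adj (g k i) (g l j)"
        using V uv u v gL[of k i] gL[of l j] L_adj[of k "g k i" "g l j"] L_spine[of k l] by auto
      then show ?thesis
        using 4 V uv u v by (simp add: h_def parcs_path_with_pendants)
    qed
  qed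
  have "?P \<simeq>\<^sub>g T"
    using graph_isoI[OF _ _ bij arc] pair_wf_digraph
      pair_digraph.pair_wf_digraph[OF pair_graph.axioms(1)[OF pair_graph_path_with_pendants]]
    by blast
  then show ?thesis
    by (rule graph_iso_sym)
qed

section \<open>Longest paths\<close>

text \<open>
  A path is a tree rooted at its first vertex; therefore it has no chords by the general
  result on embedded trees.
\<close>

definition simple_path :: "'a list \<Rightarrow> bool" where
  "simple_path xs \<longleftrightarrow> embedded (\<lambda>j. j - 1) xs"

lemma simple_path_iff:
  "simple_path xs \<longleftrightarrow> xs \<noteq> [] \<and> distinct xs \<and> set xs \<subseteq> pverts T \<and> successively adj xs"
proof -
  have "(\<forall>j. 0 < j \<and> j < length xs \<longrightarrow> adj (xs ! (j - 1)) (xs ! j)) \<longleftrightarrow>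
      (\<forall>i. Suc i < length xs \<longrightarrow> adj (xs ! i) (xs ! Suc i))"
    by (metis Suc_pred' diff_Suc_1 zero_less_Suc)
  then show ?thesis
    unfolding simple_path_def embedded_def successively_conv_nth by auto
qed

lemma simple_path_adj_iff:
  assumes "simple_path xs" "i < length xs" "j < length xs"
  shows "adj (xs ! i) (xs ! j) \<longleftrightarrow> j = Suc i \<or> i = Suc j"
proof -
  note emb = assms(1)[unfolded simple_path_def]
  show ?thesis
  proof (cases i j rule: linorder_cases)
    case less
    then show ?thesis
      using embedded_adj_iff[OF emb less assms(3)] by auto
  next
    case greater
    then have "adj (xs ! j) (xs ! i) \<longleftrightarrow> i = Suc j"
      using embedded_adj_iff[OF emb greater assms(2)] by auto
    moreover have "adj (xs ! i) (xs ! j) \<longleftrightarrow> adj (xs ! j) (xs ! i)"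
      by (rule adj_sym)
    ultimately show ?thesis
      using greater by simp
  qed simp
qed

definition longest_path :: "'a list \<Rightarrow> bool" where
  "longest_path xs \<longleftrightarrow> simple_path xs \<and> (\<forall>ys. simple_path ys \<longrightarrow> length ys \<le> length xs)"

lemma longest_path_exists: "\<exists>xs. longest_path xs"
proof -
  obtain u where "u \<in> pverts T"
    using undirected_tree
    by (auto simp: undirected_tree_def Digraph_Component.connected_def strongly_connected_def)
  then have "simple_path [u]"
    by (simp add: simple_path_iff)
  moreover have "\<forall>ys. simple_path ys \<longrightarrow> length ys < Suc (card (pverts T))"
    unfolding simple_path_iff by (metis card_mono distinct_card le_imp_less_Suc pair_finite_verts)
  ultimately show ?thesis
    unfolding longest_path_def using ex_has_greatest_nat[of simple_path "[u]" length "Suc (card (pverts T))"] by blast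
qed

lemma longest_path_rev: "longest_path xs \<Longrightarrow> longest_path (rev xs)"
  using arcs_symmetric unfolding longest_path_def simple_path_iff
  by (auto intro: successively_mono)

text \<open>
  A neighbour on the path other than the second vertex would be a chord, and one outside would
  make the path longer.
\<close>

lemma end_of_longest_path:
  assumes "longest_path xs" "2 \<le> length xs" "adj (xs ! 0) z"
  shows "z = xs ! 1"
proof (cases "z \<in> set xs")
  case True
  then obtain j where j: "j < length xs" "z = xs ! j"
    by (metis in_set_conv_nth)
  have "simple_path xs"
    using assms(1) by (simp add: longest_path_def)
  from simple_path_adj_iff[OF this, of 0 j] show ?thesis
    using j assms(2,3) by fastforce
next
  case False
  then have "simple_path (z # xs)"
    using assms arcs_symmetric[OF assms(3)] wellformed'[OF assms(3)]
    by (auto simp: longest_path_def simple_path_iff successively_Cons hd_conv_nth)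
  then show ?thesis
    using assms(1) by (fastforce simp: longest_path_def)
qed

text \<open>
  Replacing the first vertex of the path by such a neighbour gives another longest path, to
  which the statement about end vertices applies.
\<close>

lemma neighbour_of_second:
  assumes "longest_path xs" "2 \<le> length xs" "adj (xs ! 1) y" "y \<notin> set (tl xs)" "adj y z"
  shows "z = xs ! 1"
proof -
  obtain a b ys where xs: "xs = a # b # ys"
    using assms(2) by (cases xs; cases "tl xs") auto
  have "simple_path (y # b # ys)"
    using assms xs arcs_symmetric[OF assms(3)] wellformed'[OF assms(3)]
    by (auto simp: longest_path_def simple_path_iff)
  then have "longest_path (y # b # ys)"
    using assms(1) xs by (simp add: longest_path_def)
  from end_of_longest_path[OF this, of z] show ?thesis
    using assms(5) xs by simp
qed

text \<open>
  The inner vertices of the path. The two end vertices count as pendants.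
\<close>

definition spine :: "'a list \<Rightarrow> 'a set" where
  "spine xs = (!) xs ` {1..length xs - 2}"

lemma spine_rev: "spine (rev xs) = spine xs"
proof -
  have "spine (rev xs) \<subseteq> spine xs" for xs :: "'a list"
  proof
    fix x assume "x \<in> spine (rev xs)"
    then obtain k where "k \<in> {1..length xs - 2}" "x = rev xs ! k"
      by (auto simp: spine_def)
    then have "x = xs ! (length xs - 1 - k)" "length xs - 1 - k \<in> {1..length xs - 2}"
      by (auto simp: rev_nth)
    then show "x \<in> spine xs"
      by (auto simp: spine_def)
  qed
  from this[of xs] this[of "rev xs"] show ?thesis by simp
qed

text \<open>
  A neighbour of the second vertex that lies later on the path belongs to the spine, unless the
  path has only three vertices; then it is the last vertex, which is an end of the reversed path.
\<close>

lemma pendant_at_second: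
  assumes "longest_path xs" "3 \<le> length xs" "adj (xs ! 1) y" "y \<notin> spine xs" "adj y z"
  shows "z = xs ! 1"
proof (cases "y \<in> set (tl xs)")
  case True
  then obtain i where "i < length (tl xs)" "y = tl xs ! i"
    by (metis in_set_conv_nth)
  then have j: "Suc i < length xs" "y = xs ! Suc i"
    by (auto simp: nth_tl)
  have xs: "simple_path xs"
    using assms(1) by (simp add: longest_path_def)
  have "Suc i = 2"
    using simple_path_adj_iff[OF xs _ j(1), of 1] assms(2,3) j(2) by auto
  moreover have "\<not> Suc i \<le> length xs - 2"
    using assms(4) j(2) by (auto simp: spine_def)
  ultimately have len: "length xs = 3"
    using j(1) by simp
  then have "rev xs ! 0 = y" "rev xs ! 1 = xs ! 1"
    using j \<open>Suc i = 2\<close> by (simp_all add: rev_nth)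
  then show ?thesis
    using end_of_longest_path[OF longest_path_rev[OF assms(1)], of z] assms(5) len by simp
next
  case False
  then show ?thesis
    using neighbour_of_second[OF assms(1) _ assms(3) False assms(5)] assms(2) by simp
qed

lemma pendant_at_second_last:
  assumes "longest_path xs" "3 \<le> length xs" "adj (xs ! (length xs - 2)) y" "y \<notin> spine xs" "adj y z"
  shows "z = xs ! (length xs - 2)"
proof -
  have "rev xs ! 1 = xs ! (length xs - 2)"
    using assms(2) by (simp add: rev_nth numeral_2_eq_2)
  then show ?thesis
    using pendant_at_second[OF longest_path_rev[OF assms(1)], of y z] assms spine_rev by simp
qed

lemma inner_neighbour_notin_path:
  assumes "simple_path xs" "k \<in> {2..length xs - 3}" "adj (xs ! k) y" "y \<notin> spine xs"
  shows "y \<notin> set xs"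
proof
  assume "y \<in> set xs"
  then obtain j where j: "j < length xs" "y = xs ! j"
    by (metis in_set_conv_nth)
  then have "j = Suc k \<or> k = Suc j"
    using simple_path_adj_iff[OF assms(1), of k j] assms(2,3) by auto
  then have "j \<in> {1..length xs - 2}"
    using assms(2) by auto
  then show False
    using assms(4) j(2) by (simp add: spine_def)
qed

text \<open>
  By maximality the neighbours of the two outermost inner vertices are leaves automatically,
  so that only the vertices \<open>xs ! k\<close> with \<open>2 \<le> k \<le> length xs - 3\<close> can carry larger branches.
\<close>

lemma iso_of_longest_path:
  assumes longest: "longest_path xs" and len: "3 \<le> length xs"
    and inner: "\<And>k y z. k \<in> {2..length xs - 3} \<Longrightarrow> adj (xs ! k) y \<Longrightarrow> y \<notin> spine xs \<Longrightarrow>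
      adj y z \<Longrightarrow> z = xs ! k"
    and r: "\<And>k. k \<in> {1..length xs - 2} \<Longrightarrow> r k = card ({y. adj (xs ! k) y} - spine xs)"
  shows "T \<simeq>\<^sub>g path_with_pendants (length xs - 2) r"
proof (rule iso_path_with_pendants[where c = "(!) xs"])
  have xs: "simple_path xs"
    using longest by (simp add: longest_path_def)
  then have "distinct xs" "set xs \<subseteq> pverts T"
    by (simp_all add: simple_path_iff)
  then show "inj_on ((!) xs) {1..length xs - 2}"
    using len by (auto intro!: inj_on_nth)
  show "(!) xs ` {1..length xs - 2} \<subseteq> pverts T"
  proof (rule image_subsetI)
    fix k assume "k \<in> {1..length xs - 2}"
    then have "xs ! k \<in> set xs"
      using len by (intro nth_mem) auto
    then show "xs ! k \<in> pverts T"
      using \<open>set xs \<subseteq> pverts T\<close> by blast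
  qed
  show "1 \<le> length xs - 2"
    using len by simp
  show "adj (xs ! k) (xs ! l) \<longleftrightarrow> l = Suc k \<or> k = Suc l"
    if "k \<in> {1..length xs - 2}" "l \<in> {1..length xs - 2}" for k l
    using that len by (intro simple_path_adj_iff[OF xs]) auto
  show "z = xs ! k"
    if k: "k \<in> {1..length xs - 2}" and y: "adj (xs ! k) y" "y \<notin> (!) xs ` {1..length xs - 2}" "adj y z"
    for k y z
  proof -
    have y': "y \<notin> spine xs" using y(2) by (simp add: spine_def)
    consider "k = 1" | "k = length xs - 2" | "k \<in> {2..length xs - 3}"
      using k by fastforce
    then show ?thesis
    proof cases
      case 1
      then show ?thesis using pendant_at_second[OF longest len _ y' y(3)] y(1) by simp
    next
      case 2
      then show ?thesis using pendant_at_second_last[OF longest len _ y' y(3)] y(1) by simp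
    next
      case 3
      then show ?thesis using inner y' y by blast
    qed
  qed
qed (use r in \<open>simp add: spine_def\<close>)

lemma card_pendants_pos:
  assumes "longest_path xs" "3 \<le> length xs" "k = 1 \<or> k = length xs - 2"
  shows "1 \<le> card ({y. adj (xs ! k) y} - spine xs)"
proof -
  have xs: "simple_path xs"
    using assms(1) by (simp add: longest_path_def)
  then have "distinct xs"
    by (simp add: simple_path_iff)
  \<comment> \<open>The end of the path next to \<open>xs ! k\<close> is the pendant that must exist.\<close>
  define e where "e = (if k = 1 then 0 else length xs - 1)"
  have e: "e < length xs" "e \<notin> {1..length xs - 2}" "k = Suc e \<or> e = Suc k" "k < length xs"
    using assms(2,3) by (auto simp: e_def)
  have "xs ! e \<notin> spine xs"
    using e \<open>distinct xs\<close> by (auto simp: spine_def nth_eq_iff_index_eq)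
  moreover have "adj (xs ! k) (xs ! e)"
    using simple_path_adj_iff[OF xs e(4,1)] e(3) by blast
  moreover have "finite {y. adj (xs ! k) y}"
    by (rule finite_subset[OF _ pair_finite_verts]) (auto dest: wellformed')
  ultimately show ?thesis
    by (metis (mono_tags, lifting) DiffI One_nat_def Suc_leI card_gt_0_iff empty_iff finite_Diff
        mem_Collect_eq)
qed

section \<open>Classification of trees by a longest path\<close>

lemma six_le_card_MIS_of_long_path:
  assumes "simple_path xs" "7 \<le> length xs"
  shows "6 \<le> card (MIS T)"
proof (rule six_le_card_MIS_of_path7)
  show "embedded (\<lambda>j. j - 1) (take 7 xs)"
    using assms by (auto simp: simple_path_def embedded_def dest: in_set_takeD)
qed (use assms in simp)

lemma embedded_length7:
  assumes "length vs = 7" "distinct vs" "set vs \<subseteq> pverts T"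
    and "\<forall>j\<in>{1,2,3,4,5,6}. par j < j \<and> adj (vs ! par j) (vs ! j)"
  shows "embedded par vs"
proof -
  have "j \<in> {1,2,3,4,5,6}" if "0 < j" "j < length vs" for j
    using that assms(1) by auto
  then have "par j < j \<and> adj (vs ! par j) (vs ! j)" if "0 < j" "j < length vs" for j
    using assms(4) that by blast
  moreover have "vs \<noteq> []"
    using assms(1) by auto
  ultimately show ?thesis
    unfolding embedded_def using assms(2,3) by blast
qed

text \<open>
  A branch of depth two at the middle of a path on five vertices completes the spider with
  legs \<open>2, 2, 2\<close>.
\<close>

lemma six_le_card_MIS_of_branch_at_middle5:
  assumes xs: "simple_path xs" "length xs = 5"
    and y: "adj (xs ! 2) y" "y \<notin> set xs" and z: "adj y z" "z \<noteq> xs ! 2"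
  shows "6 \<le> card (MIS T)"
proof -
  have "z \<notin> set xs"
  proof
    assume "z \<in> set xs"
    moreover have "xs ! 2 \<in> set xs"
      using xs(2) by simp
    ultimately show False
      using unique_neighbour[OF embedded_subtree_all[OF xs(1)[unfolded simple_path_def]] y(2),
          of "xs ! 2" z] arcs_symmetric[OF y(1)] z by blast
  qed
  obtain a b c d e where abcde: "xs = [a, b, c, d, e]"
    using xs(2) by (auto simp: numeral_eq_Suc length_Suc_conv)
  have path: "adj a b" "adj b c" "adj c d" "adj d e" "distinct [a, b, c, d, e]"
    "{a, b, c, d, e} \<subseteq> pverts T"
    using xs(1) by (simp_all add: abcde simple_path_iff)
  have "adj b a" "adj c b" "y \<noteq> z" "y \<in> pverts T" "z \<in> pverts T"
    using arcs_symmetric[OF path(1)] arcs_symmetric[OF path(2)] wellformed'[OF z(1)] no_loops'[OF z(1)]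
    by simp_all
  then have "embedded (\<lambda>j. [0,0,1,0,3,0,5] ! j) [c, b, a, d, e, y, z]"
    using path y z(1) \<open>z \<notin> set xs\<close> by (intro embedded_length7) (simp_all add: abcde, auto)
  then show ?thesis
    by (rule six_le_card_MIS_of_spider222) simp
qed

text \<open>
  Any additional neighbour of the third of six path vertices completes the spider with legs
  \<open>1, 2, 3\<close>.
\<close>

lemma six_le_card_MIS_of_branch_at_third6:
  assumes xs: "simple_path xs" "length xs = 6" and y: "adj (xs ! 2) y" "y \<notin> set xs"
  shows "6 \<le> card (MIS T)"
proof -
  obtain a b c d e f where abcdef: "xs = [a, b, c, d, e, f]"
    using xs(2) by (auto simp: numeral_eq_Suc length_Suc_conv)
  have path: "adj a b" "adj b c" "adj c d" "adj d e" "adj e f" "distinct [a, b, c, d, e, f]"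
    "{a, b, c, d, e, f} \<subseteq> pverts T"
    using xs(1) by (simp_all add: abcdef simple_path_iff)
  have "adj b a" "adj c b" "y \<in> pverts T"
    using arcs_symmetric[OF path(1)] arcs_symmetric[OF path(2)] wellformed'[OF y(1)] by simp_all
  then have "embedded (\<lambda>j. [0,0,0,2,0,4,5] ! j) [c, y, b, a, d, e, f]"
    using path y by (intro embedded_length7) (simp_all add: abcdef, auto)
  then show ?thesis
    by (rule six_le_card_MIS_of_spider123) simp
qed

text \<open>
  The number of vertices of a longest path decides which family occurs; what does not belong to
  a family contains one of the three forbidden trees.
\<close>

lemma classification:
  "card (pverts T) = 1 \<or>
   (\<exists>n\<ge>2. T \<simeq>\<^sub>g star (n - 1)) \<or>
   (\<exists>p\<ge>1. \<exists>q\<ge>1. T \<simeq>\<^sub>g S 2 p q) \<or>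
   (\<exists>p\<ge>1. \<exists>q\<ge>1. T \<simeq>\<^sub>g S 3 p q) \<or>
   (\<exists>p\<ge>1. \<exists>q\<ge>1. T \<simeq>\<^sub>g S 4 p q) \<or>
   (\<exists>p\<ge>1. \<exists>q\<ge>1. \<exists>r\<ge>1. T \<simeq>\<^sub>g S3 p q r) \<or>
   6 \<le> card (MIS T)"
  (is "?one \<or> ?star \<or> ?S2 \<or> ?S3 \<or> ?S4 \<or> ?S3m \<or> ?six")
proof -
  obtain xs where longest: "longest_path xs"
    using longest_path_exists by blast
  then have xs: "simple_path xs"
    by (simp add: longest_path_def)
  then have ne: "xs \<noteq> []" and sub: "set xs \<subseteq> pverts T"
    by (auto simp: simple_path_iff)
  define r where "r k = card ({y. adj (xs ! k) y} - spine xs)" for k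
  have pos: "1 \<le> r 1 \<and> 1 \<le> r (length xs - 2)" if "3 \<le> length xs"
    unfolding r_def using card_pendants_pos[OF longest that] by blast
  have zero: "r k = 0" if "\<And>y. adj (xs ! k) y \<Longrightarrow> y \<notin> spine xs \<Longrightarrow> False" for k
  proof -
    have "{y. adj (xs ! k) y} - spine xs = {}"
      using that by blast
    then show ?thesis by (simp only: r_def card.empty)
  qed
  consider "length xs = 1" | "length xs = 2" | "length xs = 3" | "length xs = 4" | "length xs = 5"
    | "length xs = 6" | "7 \<le> length xs"
  proof -
    have "length xs \<noteq> 0"
      using ne by simp
    then have "length xs = 1 \<or> length xs = 2 \<or> length xs = 3 \<or> length xs = 4 \<or> length xs = 5 \<or>
        length xs = 6 \<or> 7 \<le> length xs"
      by linarith
    then show thesis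
      using that by blast
  qed
  then show ?thesis
  proof cases
    case 1
    then obtain a where a: "xs = [a]"
      by (auto simp: length_Suc_conv)
    have "\<not> adj a b" for b
    proof
      assume "adj a b"
      then have "simple_path [a, b]"
        using wellformed' no_loops' by (auto simp: simple_path_iff)
      then show False
        using longest a by (fastforce simp: longest_path_def)
    qed
    then have "{a} = pverts T"
      using sub a by (intro closed_eq_pverts[of a]) auto
    then have ?one
      by (metis is_singletonI is_singleton_altdef)
    then show ?thesis ..
  next
    case 2
    then obtain a b where ab: "xs = [a, b]"
      by (auto simp: length_Suc_conv eval_nat_numeral)
    \<comment> \<open>The one-vertex path \<open>b\<close> serves as spine; \<open>a\<close> is then one of its pendants.\<close>
    define m where "m = card ({y. adj b y} - (\<lambda>_. b) ` {1..1::nat})"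
    have "T \<simeq>\<^sub>g path_with_pendants 1 (\<lambda>_. m)"
    proof (rule iso_path_with_pendants[where c = "\<lambda>_. b"])
      show "z = b" if "adj b y" "y \<notin> (\<lambda>_. b) ` {1..1::nat}" "adj y z" for y z
        using neighbour_of_second[OF longest, of y z] that ab by simp
    qed (use ab sub m_def in auto)
    moreover have "1 \<le> m"
    proof -
      have "a \<in> {y. adj b y} - (\<lambda>_. b) ` {1..1::nat}"
        using xs ab arcs_symmetric by (auto simp: simple_path_iff)
      moreover have "finite {y. adj b y}"
        by (rule finite_subset[OF _ pair_finite_verts]) (auto dest: wellformed')
      ultimately show ?thesis
        unfolding m_def by (metis One_nat_def Suc_leI card_gt_0_iff empty_iff finite_Diff)
    qed
    ultimately have ?star
      by (intro exI[of _ "Suc m"]) (simp add: star_def)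
    then show ?thesis by blast
  next
    case 3
    have "T \<simeq>\<^sub>g path_with_pendants 1 (\<lambda>_. r 1)"
      using iso_of_longest_path[OF longest, of "\<lambda>_. r 1"] 3 by (simp add: r_def)
    then have ?star
      using pos 3 by (intro exI[of _ "Suc (r 1)"]) (simp add: star_def)
    then show ?thesis by blast
  next
    case 4
    have "T \<simeq>\<^sub>g path_with_pendants (length xs - 2)
        (\<lambda>k. if k = 1 then r 1 else if k = 2 then r 2 else 0)"
    proof (rule iso_of_longest_path[OF longest])
      fix k assume "k \<in> {1..length xs - 2}"
      then have "k = 1 \<or> k = 2" using 4 by auto
      then show "(if k = 1 then r 1 else if k = 2 then r 2 else 0) =
          card ({y. adj (xs ! k) y} - spine xs)"
        by (auto simp: r_def)
    qed (use 4 in auto)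
    then have "T \<simeq>\<^sub>g S 2 (r 1) (r 2)"
      using 4 by (simp add: S_def del: One_nat_def)
    then have ?S2
      using pos 4 by auto
    then show ?thesis by blast
  next
    case 5
    show ?thesis
    proof (cases "\<forall>y z. adj (xs ! 2) y \<longrightarrow> y \<notin> spine xs \<longrightarrow> adj y z \<longrightarrow> z = xs ! 2")
      case True
      have iso: "T \<simeq>\<^sub>g path_with_pendants 3 r'" if "\<And>k. k \<in> {1..3} \<Longrightarrow> r' k = r k" for r'
        using iso_of_longest_path[OF longest, of r'] 5 True that by (simp add: r_def)
      have index: "k = 1 \<or> k = 2 \<or> k = 3" if "k \<in> {1..3}" for k :: nat
        using that by auto
      show ?thesis
      proof (cases "r 2 = 0")
        case True
        then have "T \<simeq>\<^sub>g S 3 (r 1) (r 3)"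
          unfolding S_def by (intro iso) (use index in fastforce)
        then have ?S3
          using pos 5 by auto
        then show ?thesis by blast
      next
        case False
        then have "1 \<le> r 2" by linarith
        moreover have "T \<simeq>\<^sub>g S3 (r 1) (r 3) (r 2)"
          unfolding S3_def by (intro iso) (use index in fastforce)
        ultimately have ?S3m
          using pos 5 by auto
        then show ?thesis by blast
      qed
    next
      case False
      then obtain y z where yz: "adj (xs ! 2) y" "y \<notin> spine xs" "adj y z" "z \<noteq> xs ! 2"
        by blast
      moreover have "y \<notin> set xs"
        using inner_neighbour_notin_path[OF xs _ yz(1,2)] 5 by simp
      ultimately show ?thesis
        using six_le_card_MIS_of_branch_at_middle5[OF xs 5] by blast
    qed
  next
    case 6
    show ?thesis
    proof (cases "\<exists>k\<in>{2, 3}. \<exists>y. adj (xs ! k) y \<and> y \<notin> spine xs")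
      case True
      then obtain k y where k: "k \<in> {2, 3}" and y: "adj (xs ! k) y" "y \<notin> spine xs"
        by blast
      have "y \<notin> set xs"
        using inner_neighbour_notin_path[OF xs _ y] k 6 by auto
      \<comment> \<open>Reversing the path turns the fourth vertex into the third.\<close>
      define ys where "ys = (if k = 2 then xs else rev xs)"
      have "simple_path ys" "length ys = 6" "set ys = set xs" "ys ! 2 = xs ! k"
        using xs longest_path_rev[OF longest] k 6
        by (auto simp: ys_def longest_path_def rev_nth)
      then have ?six
        using six_le_card_MIS_of_branch_at_third6[of ys y] y \<open>y \<notin> set xs\<close> by simp
      then show ?thesis by blast
    next
      case none: False
      have inner: "k = 2 \<or> k = 3" if "k \<in> {2..3}" for k :: nat
        using that by auto
      have "T \<simeq>\<^sub>g path_with_pendants (length xs - 2)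
          (\<lambda>k. if k = 1 then r 1 else if k = 4 then r 4 else 0)"
      proof (rule iso_of_longest_path[OF longest])
        show "z = xs ! k" if "k \<in> {2..length xs - 3}" "adj (xs ! k) y" "y \<notin> spine xs" for k y z
          using that none inner 6 by auto
        show "(if k = 1 then r 1 else if k = 4 then r 4 else 0) =
            card ({y. adj (xs ! k) y} - spine xs)"
          if k: "k \<in> {1..length xs - 2}" for k
        proof (cases "k = 1 \<or> k = 4")
          case False
          then have "k \<in> {2..length xs - 3}" "k = 2 \<or> k = 3"
            using k 6 by auto
          then show ?thesis
            using zero[of k] none by (auto simp: r_def)
        qed (auto simp: r_def)
      qed (use 6 in simp)
      then have "T \<simeq>\<^sub>g S 4 (r 1) (r 4)"
        using 6 by (simp add: S_def del: One_nat_def)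
      then have ?S4
        using pos 6 by auto
      then show ?thesis by blast
    qed
  next
    case 7
    then show ?thesis
      using six_le_card_MIS_of_long_path[OF xs] by blast
  qed
qed

end

section \<open>The five cases\<close>

theorem lemma12:
  fixes T :: "'a pair_pre_digraph"
  assumes "undirected_tree T"
  shows "(card (MIS T) = 1 \<longleftrightarrow> card (pverts T) = 1) \<and>
    (card (MIS T) = 2 \<longleftrightarrow> (\<exists>n\<ge>2. T \<simeq>\<^sub>g star (n - 1))) \<and>
    (card (MIS T) = 3 \<longleftrightarrow> (\<exists>p\<ge>1. \<exists>q\<ge>1. T \<simeq>\<^sub>g S 2 p q)) \<and>
    (card (MIS T) = 4 \<longleftrightarrow> (\<exists>p\<ge>1. \<exists>q\<ge>1. T \<simeq>\<^sub>g S 3 p q)) \<and>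
    (card (MIS T) = 5 \<longleftrightarrow>
       (\<exists>p\<ge>1. \<exists>q\<ge>1. T \<simeq>\<^sub>g S 4 p q) \<or>
       (\<exists>p\<ge>1. \<exists>q\<ge>1. \<exists>r\<ge>1. T \<simeq>\<^sub>g S3 p q r))"
proof -
  interpret undirected_tree_graph T by unfold_locales fact
  note iso = card_MIS_cong[OF _ pair_finite_verts]
  have one: "card (MIS T) = 1" if "card (pverts T) = 1"
    by (rule card_MIS_singleton[OF pair_graph that])
  have star: "card (MIS T) = 2" if "T \<simeq>\<^sub>g star (n - 1)" "2 \<le> n" for n
  proof -
    have "1 \<le> n - 1"
      using that(2) by simp
    with iso[OF that(1)] show ?thesis
      by (rule trans[OF _ card_MIS_star])
  qed
  have S2: "card (MIS T) = 3" if "T \<simeq>\<^sub>g S 2 p q" "1 \<le> p" "1 \<le> q" for p q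
    using iso[OF that(1)] card_MIS_S2[OF that(2,3)] by (rule trans)
  have S3: "card (MIS T) = 4" if "T \<simeq>\<^sub>g S 3 p q" "1 \<le> p" "1 \<le> q" for p q
    using iso[OF that(1)] card_MIS_S3[OF that(2,3)] by (rule trans)
  have S4: "card (MIS T) = 5" if "T \<simeq>\<^sub>g S 4 p q" "1 \<le> p" "1 \<le> q" for p q
    using iso[OF that(1)] card_MIS_S4[OF that(2,3)] by (rule trans)
  have S3m: "card (MIS T) = 5" if "T \<simeq>\<^sub>g S3 p q r" "1 \<le> p" "1 \<le> q" "1 \<le> r" for p q r
    using iso[OF that(1)] card_MIS_S3_middle[OF that(2,3,4)] by (rule trans)
  have combine: "(c = 1 \<longleftrightarrow> P1) \<and> (c = 2 \<longleftrightarrow> P2) \<and> (c = 3 \<longleftrightarrow> P3) \<and> (c = 4 \<longleftrightarrow> P4) \<and>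
      (c = 5 \<longleftrightarrow> P5 \<or> P6)"
    if cover: "P1 \<or> P2 \<or> P3 \<or> P4 \<or> P5 \<or> P6 \<or> 6 \<le> c"
      and count: "P1 \<Longrightarrow> c = 1" "P2 \<Longrightarrow> c = 2" "P3 \<Longrightarrow> c = 3"
        "P4 \<Longrightarrow> c = 4" "P5 \<Longrightarrow> c = 5" "P6 \<Longrightarrow> c = 5"
    for c :: nat and P1 P2 P3 P4 P5 P6
  proof -
    consider "c = 1" P1 | "c = 2" P2 | "c = 3" P3 | "c = 4" P4 | "c = 5" P5 | "c = 5" P6 | "6 \<le> c"
      using cover count by blast
    then show ?thesis
      by cases (use count in auto)
  qed
  show ?thesis
  proof (rule combine[OF classification one])
    show "card (MIS T) = 2" if "\<exists>n\<ge>2. T \<simeq>\<^sub>g star (n - 1)"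
      using that star by blast
    show "card (MIS T) = 3" if "\<exists>p\<ge>1. \<exists>q\<ge>1. T \<simeq>\<^sub>g S 2 p q"
      using that S2 by blast
    show "card (MIS T) = 4" if "\<exists>p\<ge>1. \<exists>q\<ge>1. T \<simeq>\<^sub>g S 3 p q"
      using that S3 by blast
    show "card (MIS T) = 5" if "\<exists>p\<ge>1. \<exists>q\<ge>1. T \<simeq>\<^sub>g S 4 p q"
      using that S4 by blast
    show "card (MIS T) = 5" if "\<exists>p\<ge>1. \<exists>q\<ge>1. \<exists>r\<ge>1. T \<simeq>\<^sub>g S3 p q r"
      using that S3m by blast
  qed
qed

end
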